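(* Let $n\ge 1$, let $\boldsymbol I\in\mathbb Z_{\ge 0}^n$ be an inventory vector, let $\mathcal A(\boldsymbol I)=\{i\in\{1,\dots,n\}: I_i>0\}$, and let $$\mathcal C(\boldsymbol I)=\Big\{\boldsymbol y=(y_0,\dots,y_n)\in\mathbb R_{\ge 0}^{n+1} : \sum_{i\in\mathcal A(\boldsymbol I)\cup\{0\}} y_i=1,\ y_i=0 \text{ for } i\notin\mathcal A(\boldsymbol I)\cup\{0\}\Big\}.$$ Define $\Omega(\boldsymbol y)=\sum_{i=0}^{n} y_i(\log y_i-\log y_0)$ for $\boldsymbol y\in\mathcal C(\boldsymbol I)$. Then $\Omega$ is smooth and strictly convex on the relative interior of $\mathcal C(\boldsymbol I)$, and $\Omega$ is of Legendre type.
   Context: Conventions: terms with $y_i=0$ contribute $0$ to $\Omega(\boldsymbol y)$ when $y_0>0$ (i.e. $0\log 0=0$, and in particular coordinates of unavailable products contribute $0$), and $\Omega(\boldsymbol y)=+\infty$ when $y_0=0$; $\Omega=+\infty$ outside $\mathcal C(\boldsymbol I)$. Legendre type is understood relative to the affine hull of $\mathcal C(\boldsymbol I)$: $\Omega$ is of Legendre type if (1) the relative interior of its domain is nonempty; (2) $\Omega$ is differentiable (as a function on the affine hull) at every point of this relative interior; (3) $\|\nabla\Omega(\boldsymbol y^{(j)})\|\to+\infty$ for every sequence $(\boldsymbol y^{(j)})$ in this relative interior converging to a relative boundary point of $\mathcal C(\boldsymbol I)$, where $\nabla$ is the gradient along the affine hull; (4) $\Omega$ is strictly convex on this relative interior.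 The relative interior of $\mathcal C(\boldsymbol I)$ is the set of $\boldsymbol y\in\mathcal C(\boldsymbol I)$ with $y_i>0$ for all $i\in\mathcal A(\boldsymbol I)\cup\{0\}$. *)

theory Defs
  imports "HOL-Analysis.Analysis"
begin

section \<open>Convex analysis relative to an affine set\<close>

definition direction_space :: "'a::euclidean_space set \<Rightarrow> 'a set" where
  "direction_space A = {x - y | x y. x \<in> A \<and> y \<in> A}"

definition eff_domain :: "('a \<Rightarrow> ereal) \<Rightarrow> 'a set" where
  "eff_domain f = {x. f x < \<infinity>}"

text \<open>
  Derivatives of an extended real-valued function are those of its real part
  \<open>real_of_ereal \<circ> f\<close>. The value \<open>real_of_ereal \<infinity> = 0\<close> is
  harmless where \<open>f\<close> is finite on a neighbourhood in \<open>A\<close>; the definitions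
  below are used with points of the relative interior of the domain only.
\<close>

definition differentiable_along :: "'a::euclidean_space set \<Rightarrow> ('a \<Rightarrow> ereal) \<Rightarrow> 'a \<Rightarrow> bool" where
  "differentiable_along A f x \<longleftrightarrow>
     \<bar>f x\<bar> \<noteq> \<infinity> \<and> (real_of_ereal \<circ> f) differentiable (at x within A)"

text \<open>
  The derivative within an affine set \<open>A\<close> is determined only on the directions of \<open>A\<close>;
  the gradient along \<open>A\<close> is the unique direction of \<open>A\<close> that represents it.
\<close>

definition gradient_along :: "'a::euclidean_space set \<Rightarrow> ('a \<Rightarrow> ereal) \<Rightarrow> 'a \<Rightarrow> 'a" where
  "gradient_along A f x = (THE g. g \<in> direction_space A \<and>
     ((real_of_ereal \<circ> f) has_derivative (\<lambda>h. g \<bullet> h)) (at x within A))"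

text \<open>
  \<open>C_along k A S f\<close>: on the relatively open subset \<open>S\<close> of the affine set \<open>A\<close>, \<open>f\<close> is
  \<open>k\<close> times continuously differentiable as a function on \<open>A\<close>.
\<close>

primrec C_along :: "nat \<Rightarrow> 'a::euclidean_space set \<Rightarrow> 'a set \<Rightarrow> ('a \<Rightarrow> real) \<Rightarrow> bool" where
  "C_along 0 A S f \<longleftrightarrow> continuous_on S f"
| "C_along (Suc k) A S f \<longleftrightarrow>
     (\<forall>x\<in>S. f differentiable (at x within A)) \<and>
     (\<forall>v\<in>direction_space A. C_along k A S (\<lambda>x. frechet_derivative f (at x within A) v))"

definition smooth_along :: "'a::euclidean_space set \<Rightarrow> 'a set \<Rightarrow> ('a \<Rightarrow> ereal) \<Rightarrow> bool" where
  "smooth_along A S f \<longleftrightarrow>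
     (\<forall>x\<in>S. \<bar>f x\<bar> \<noteq> \<infinity>) \<and> (\<forall>k. C_along k A S (real_of_ereal \<circ> f))"

definition strictly_convex_on :: "'a::real_vector set \<Rightarrow> ('a \<Rightarrow> ereal) \<Rightarrow> bool" where
  "strictly_convex_on S f \<longleftrightarrow> convex S \<and>
     (\<forall>x\<in>S. \<forall>y\<in>S. \<forall>u>0. \<forall>v>0. x \<noteq> y \<longrightarrow> u + v = 1 \<longrightarrow>
        f (u *\<^sub>R x + v *\<^sub>R y) < ereal u * f x + ereal v * f y)"

text \<open>
  Here \<open>C\<close> fixes the affine hull and the relative boundary; the effective domain of \<open>f\<close>
  may be a proper subset of \<open>C\<close> (boundary points with \<open>f = \<infinity>\<close> are allowed).
\<close>

definition legendre_type :: "'a::euclidean_space set \<Rightarrow> ('a \<Rightarrow> ereal) \<Rightarrow> bool" where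
  "legendre_type C f \<longleftrightarrow>
     rel_interior (eff_domain f) \<noteq> {} \<and>
     (\<forall>x\<in>rel_interior (eff_domain f). differentiable_along (affine hull C) f x) \<and>
     (\<forall>Y z. (\<forall>j::nat. Y j \<in> rel_interior (eff_domain f)) \<longrightarrow> Y \<longlonglongrightarrow> z \<longrightarrow> z \<in> rel_frontier C \<longrightarrow>
        filterlim (\<lambda>j. norm (gradient_along (affine hull C) f (Y j))) at_top sequentially) \<and>
     strictly_convex_on (rel_interior (eff_domain f)) f"

section \<open>The choice set and the regularizer\<close>

text \<open>
  Products \<open>1, \<dots>, n\<close> are the elements of a finite type \<open>'n\<close>; coordinates
  \<open>0, 1, \<dots>, n\<close> are indexed by \<open>'n option\<close>, where \<open>None\<close> is the index \<open>0\<close>.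
\<close>

definition available :: "nat ^ 'n \<Rightarrow> 'n set" where
  "available I = {i. I $ i > 0}"

definition options0 :: "nat ^ 'n \<Rightarrow> 'n option set" where
  "options0 I = insert None (Some ` available I)"

definition choice_set :: "nat ^ 'n::finite \<Rightarrow> (real ^ ('n option)) set" where
  "choice_set I = {y. (\<forall>i. 0 \<le> y $ i) \<and> (\<Sum>i\<in>options0 I. y $ i) = 1 \<and>
                      (\<forall>i. i \<notin> options0 I \<longrightarrow> y $ i = 0)}"

text \<open>The factor \<open>y $ i\<close> makes every term with \<open>y $ i = 0\<close> vanish.\<close>

definition \<Omega> :: "nat ^ 'n::finite \<Rightarrow> real ^ ('n option) \<Rightarrow> ereal" where
  "\<Omega> I y = (if y \<in> choice_set I \<and> y $ None \<noteq> 0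
            then ereal (\<Sum>i\<in>UNIV. y $ i * (ln (y $ i) - ln (y $ None))) else \<infinity>)"

end

theory Submission
  imports Defs
begin

text \<open>
  On the hull \<open>\<Sum>i. y i = 1\<close> the regularizer is separable:
  \<open>\<Omega> y = (\<Sum>i. y i * ln (y i)) - ln (y 0)\<close>. Each summand is smooth and strictly convex on the
  positive reals, which gives smoothness and strict convexity. The gradient along the hull is the
  vector of derivatives of the summands minus its mean, so a difference of two of these derivatives
  is at most twice the norm of the gradient. At a boundary point some coordinate vanishes, where the
  derivative tends to \<open>-\<infinity>\<close>, and some coordinate stays positive, where it stays bounded.
\<close>

section \<open>Derivatives within affine sets\<close>

lemma affine_add_direction:
  assumes "affine A" "x \<in> A" "v \<in> direction_space A"
  shows "x + t *\<^sub>R v \<in> A"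
proof -
  obtain a b where "a \<in> A" "b \<in> A" "v = a - b"
    using assms(3) by (auto simp: direction_space_def)
  then show ?thesis
    using mem_affine_3_minus[OF assms(1,2), of a b t] by simp
qed

text \<open>The whole line through \<open>x\<close> in direction \<open>v\<close> stays in
  \<open>A\<close>, so both values are the ordinary derivative at 0 of one real function of
  \<open>t\<close>.\<close>

lemma has_derivative_within_affine_unique:
  fixes f :: "'a::euclidean_space \<Rightarrow> real"
  assumes "affine A" "x \<in> A" "v \<in> direction_space A"
    and "(f has_derivative f') (at x within A)" "(f has_derivative f'') (at x within A)"
  shows "f' v = f'' v"
proof -
  have line: "((\<lambda>t. f (x + t *\<^sub>R v)) has_real_derivative F v) (at 0)"
    if F: "(f has_derivative F) (at x within A)" for F
  proof -
    have 1: "((\<lambda>t::real. x + t *\<^sub>R v) has_derivative (\<lambda>t. t *\<^sub>R v)) (at 0 within UNIV)"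
      by (auto intro!: derivative_eq_intros)
    have "((\<lambda>t. f (x + t *\<^sub>R v)) has_derivative (\<lambda>t. F (t *\<^sub>R v))) (at 0 within UNIV)"
      by (rule has_derivative_in_compose[OF 1])
         (use has_derivative_subset[OF F] affine_add_direction[OF assms(1-3)] in
           \<open>simp add: image_subset_iff\<close>)
    moreover have "(\<lambda>t. F (t *\<^sub>R v)) = (*) (F v)"
      using has_derivative_bounded_linear[OF F]
      by (auto simp: linear_simps bounded_linear.linear linear_cmul)
    ultimately show ?thesis
      by (simp add: has_field_derivative_def)
  qed
  show ?thesis
    using DERIV_unique[OF line[OF assms(4)] line[OF assms(5)]] .
qed

text \<open>The difference quotient within \<open>A\<close> evaluates the linear map only at
  \<open>y - x\<close> with \<open>y\<close> in \<open>A\<close>. This allows a vector of partial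
  derivatives to be replaced by its projection onto the directions.\<close>

lemma has_derivative_within_cong_directions:
  fixes f :: "'a::euclidean_space \<Rightarrow> real"
  assumes f: "(f has_derivative f') (at x within A)" and "x \<in> A"
    and "bounded_linear f''" and eq: "\<And>h. h \<in> direction_space A \<Longrightarrow> f'' h = f' h"
  shows "(f has_derivative f'') (at x within A)"
proof -
  have "y - x \<in> direction_space A" if "y \<in> A" for y
    using that \<open>x \<in> A\<close> by (auto simp: direction_space_def)
  then have "\<forall>\<^sub>F y in at x within A.
      (1 / norm (y - x)) *\<^sub>R (f y - (f x + f' (y - x))) =
      (1 / norm (y - x)) *\<^sub>R (f y - (f x + f'' (y - x)))"
    by (auto simp: eventually_at_filter eq)
  from tendsto_cong[OF this] show ?thesis
    using f assms(3) unfolding has_derivative_within by blast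
qed

text \<open>The separable formulas used below hold on a relatively open set only, while derivatives
  are taken within all of \<open>A\<close>.\<close>

lemma has_derivative_within_transform_openin:
  assumes "openin (top_of_set A) S" "x \<in> S" "\<And>y. y \<in> S \<Longrightarrow> f y = g y"
    and "(g has_derivative g') (at x within A)"
  shows "(f has_derivative g') (at x within A)"
proof -
  obtain e where "e > 0" "ball x e \<inter> A \<subseteq> S" "x \<in> A"
    using assms(1,2) unfolding openin_contains_ball by blast
  then show ?thesis
    using has_derivative_transform_within[OF assms(4), of e f] assms(3)
    by (force simp: dist_commute)
qed

lemma gradient_along_eqI:
  assumes "affine A" "x \<in> A" "g \<in> direction_space A"
    and "((real_of_ereal \<circ> f) has_derivative (\<lambda>h. g \<bullet> h)) (at x within A)"
  shows "gradient_along A f x = g"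
  unfolding gradient_along_def
proof (rule the_equality)
  fix g' assume g': "g' \<in> direction_space A \<and>
     ((real_of_ereal \<circ> f) has_derivative (\<lambda>h. g' \<bullet> h)) (at x within A)"
  have "g' \<bullet> h = g \<bullet> h" if "h \<in> direction_space A" for h
    using has_derivative_within_affine_unique[OF assms(1,2) that conjunct2[OF g'] assms(4)] .
  \<comment> \<open>Both \<open>g'\<close> and \<open>g\<close> are themselves directions; the
    instances \<open>h = g'\<close> and \<open>h = g\<close> make the expanded square
    cancel.\<close>
  then have "(g' - g) \<bullet> (g' - g) = 0"
    using g' assms(3) by (simp add: inner_diff_left inner_diff_right)
  then show "g' = g" by simp
qed (use assms in auto)

section \<open>Separable functions\<close>

lemma separable_has_derivative:
  fixes x :: "real ^ 'k::finite"
  assumes "\<And>i. i \<in> S \<Longrightarrow> (\<phi> i has_real_derivative \<phi>' i) (at (x $ i))"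
  shows "((\<lambda>y. \<Sum>i\<in>S. \<phi> i (y $ i)) has_derivative (\<lambda>h. \<Sum>i\<in>S. \<phi>' i * h $ i)) (at x within A)"
proof (rule has_derivative_sum)
  fix i assume "i \<in> S"
  have "((\<lambda>y. y $ i) has_derivative (\<lambda>h. h $ i)) (at x within A)"
    by (rule bounded_linear_imp_has_derivative[OF bounded_linear_vec_nth])
  then show "((\<lambda>y. \<phi> i (y $ i)) has_derivative (\<lambda>h. \<phi>' i * h $ i)) (at x within A)"
    using has_derivative_compose assms[OF \<open>i \<in> S\<close>, unfolded has_field_derivative_def] by fast
qed

text \<open>\<open>D m i\<close> plays the m-th derivative of the i-th summand. A directional
  derivative of such a sum is again such a sum, with \<open>m\<close> raised by one and
  \<open>c i\<close> multiplied by \<open>v $ i\<close>; hence the induction keeps \<open>f\<close>,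
  \<open>c\<close> and \<open>m\<close> arbitrary.\<close>

lemma C_along_separable:
  fixes A P :: "(real ^ 'k::finite) set" and D :: "nat \<Rightarrow> 'k \<Rightarrow> real \<Rightarrow> real"
  assumes "affine A" and P: "openin (top_of_set A) P"
    and D: "\<And>m i x. x \<in> P \<Longrightarrow> i \<in> S \<Longrightarrow> (D m i has_real_derivative D (Suc m) i (x $ i)) (at (x $ i))"
  shows "(\<And>x. x \<in> P \<Longrightarrow> f x = (\<Sum>i\<in>S. c i * D m i (x $ i))) \<Longrightarrow> C_along k A P f"
proof (induction k arbitrary: f c m)
  case 0
  have "continuous_on P (\<lambda>x. \<Sum>i\<in>S. c i * D m i (x $ i))"
    by (rule has_derivative_continuous_on, rule separable_has_derivative, rule DERIV_cmult, rule D)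
  with 0 show ?case
    by (simp cong: continuous_on_cong)
next
  case (Suc k)
  have f: "(f has_derivative (\<lambda>h. \<Sum>i\<in>S. c i * D (Suc m) i (x $ i) * h $ i)) (at x within A)"
    if "x \<in> P" for x
    by (rule has_derivative_within_transform_openin[OF P that Suc.prems], assumption)
       (rule separable_has_derivative, rule DERIV_cmult, rule D[OF that])
  have "C_along k A P (\<lambda>x. frechet_derivative f (at x within A) v)"
    if v: "v \<in> direction_space A" for v
  proof (rule Suc.IH)
    fix x assume "x \<in> P"
    then have "x \<in> A" using P openin_imp_subset by blast
    \<comment> \<open>\<open>frechet_derivative\<close> picks some derivative within
      \<open>A\<close>; its values are determined only on directions, and \<open>v\<close> is
      one.\<close>
    have "f differentiable (at x within A)"
      using f[OF \<open>x \<in> P\<close>] by (rule differentiableI)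
    then have "(f has_derivative frechet_derivative f (at x within A)) (at x within A)"
      by (simp add: frechet_derivative_works)
    from has_derivative_within_affine_unique[OF assms(1) \<open>x \<in> A\<close> v this f[OF \<open>x \<in> P\<close>]]
    show "frechet_derivative f (at x within A) v = (\<Sum>i\<in>S. (c i * v $ i) * D (Suc m) i (x $ i))"
      by (simp add: mult_ac)
  qed
  with f show ?case
    by (auto intro: differentiableI)
qed

text \<open>Average the tangent inequalities at \<open>z $ i\<close>, taken at \<open>x $ i\<close>
  and \<open>y $ i\<close>, with weights \<open>u\<close> and \<open>v\<close>: the linear terms
  cancel. Summation keeps strictness because \<open>inj\<close> yields a coordinate in
  \<open>S\<close> where \<open>x\<close> and \<open>y\<close> differ.\<close>

lemma strictly_convex_on_separable:
  fixes P :: "(real ^ 'k::finite) set"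
  assumes "convex P"
    and f: "\<And>x. x \<in> P \<Longrightarrow> f x = ereal (\<Sum>i\<in>S. \<phi> i (x $ i))"
    and pos: "\<And>x i. x \<in> P \<Longrightarrow> i \<in> S \<Longrightarrow> x $ i > 0"
    and inj: "\<And>x y. x \<in> P \<Longrightarrow> y \<in> P \<Longrightarrow> (\<And>i. i \<in> S \<Longrightarrow> x $ i = y $ i) \<Longrightarrow> x = y"
    and tangent: "\<And>i s t. i \<in> S \<Longrightarrow> s > 0 \<Longrightarrow> t > 0 \<Longrightarrow> s \<noteq> t \<Longrightarrow> \<phi> i t > \<phi> i s + \<phi>' i s * (t - s)"
  shows "strictly_convex_on P f"
  unfolding strictly_convex_on_def
proof (intro conjI ballI allI impI)
  fix x y :: "real ^ 'k" and u v :: real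
  assume xy: "x \<in> P" "y \<in> P" and uv: "u > 0" "v > 0" "u + v = 1" and "x \<noteq> y"
  define z where "z = u *\<^sub>R x + v *\<^sub>R y"
  have z: "z \<in> P"
    using xy uv \<open>convex P\<close> unfolding z_def by (intro convexD) auto
  have strict: "\<phi> i (z $ i) < u * \<phi> i (x $ i) + v * \<phi> i (y $ i)" if "i \<in> S" "x $ i \<noteq> y $ i" for i
  proof -
    have v: "v = 1 - u" using uv by simp
    have zx: "x $ i - z $ i = v * (x $ i - y $ i)" and zy: "y $ i - z $ i = u * (y $ i - x $ i)"
      unfolding z_def v by (simp_all add: algebra_simps)
    have "z $ i \<noteq> x $ i" "z $ i \<noteq> y $ i"
      using zx zy uv that by auto
    then have "u * (\<phi> i (z $ i) + \<phi>' i (z $ i) * (x $ i - z $ i)) < u * \<phi> i (x $ i)"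
      "v * (\<phi> i (z $ i) + \<phi>' i (z $ i) * (y $ i - z $ i)) < v * \<phi> i (y $ i)"
      using tangent that pos xy z uv by auto
    moreover have "u * (\<phi> i (z $ i) + \<phi>' i (z $ i) * (x $ i - z $ i))
        + v * (\<phi> i (z $ i) + \<phi>' i (z $ i) * (y $ i - z $ i)) = \<phi> i (z $ i)"
      unfolding zx zy v by (simp add: algebra_simps)
    ultimately show ?thesis by linarith
  qed
  have weak: "\<phi> i (z $ i) \<le> u * \<phi> i (x $ i) + v * \<phi> i (y $ i)" if "i \<in> S" for i
  proof (cases "x $ i = y $ i")
    case True
    then have "z $ i = y $ i"
      using uv(3) by (simp add: z_def flip: distrib_right)
    with True uv(3) show ?thesis by (simp flip: distrib_right)
  qed (use strict[OF that] in simp)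
  have "\<exists>i\<in>S. x $ i \<noteq> y $ i"
    using inj xy \<open>x \<noteq> y\<close> by blast
  then have "(\<Sum>i\<in>S. \<phi> i (z $ i)) < (\<Sum>i\<in>S. u * \<phi> i (x $ i) + v * \<phi> i (y $ i))"
    using strict weak by (intro sum_strict_mono_ex1) auto
  then show "f (u *\<^sub>R x + v *\<^sub>R y) < ereal u * f x + ereal v * f y"
    using xy z by (simp add: f flip: z_def) (simp add: sum.distrib sum_distrib_left)
qed fact

section \<open>The simplex on a set of coordinates\<close>

definition simplex_hull :: "'k set \<Rightarrow> (real ^ 'k::finite) set" where
  "simplex_hull S = {y. (\<Sum>i\<in>S. y $ i) = 1 \<and> (\<forall>i. i \<notin> S \<longrightarrow> y $ i = 0)}"

definition simplex_closed :: "'k set \<Rightarrow> (real ^ 'k::finite) set" where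
  "simplex_closed S = {y \<in> simplex_hull S. \<forall>i. 0 \<le> y $ i}"

definition simplex_open :: "'k set \<Rightarrow> (real ^ 'k::finite) set" where
  "simplex_open S = {y \<in> simplex_hull S. \<forall>i\<in>S. 0 < y $ i}"

lemma simplex_open_subset_closed: "simplex_open S \<subseteq> simplex_closed S"
proof
  fix y assume "y \<in> simplex_open S"
  moreover from this have "0 \<le> y $ i" for i
    by (cases "i \<in> S") (auto simp: simplex_open_def simplex_hull_def less_imp_le)
  ultimately show "y \<in> simplex_closed S"
    by (simp add: simplex_open_def simplex_closed_def)
qed

lemma affine_simplex_hull: "affine (simplex_hull S)"
  unfolding affine_def simplex_hull_def
  by (auto simp: sum.distrib simp flip: sum_distrib_left)

lemma convex_simplex_closed: "convex (simplex_closed S)"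
  unfolding convex_def simplex_closed_def simplex_hull_def
  by (auto simp: sum.distrib simp flip: sum_distrib_left)

lemma closed_simplex_closed: "closed (simplex_closed S)"
  unfolding simplex_closed_def simplex_hull_def
  by (auto intro!: closed_Collect_conj closed_Collect_eq closed_Collect_le closed_Collect_all
      closed_Collect_imp continuous_intros)

text \<open>An affine set cut by an open set: this form yields both the relative openness and the
  affine hull.\<close>

lemma simplex_open_eq_Int: "simplex_open S = simplex_hull S \<inter> (\<Inter>i\<in>S. {y. 0 < y $ i})"
  by (auto simp: simplex_open_def)

lemma open_positive_coordinates: "open (\<Inter>i\<in>S. {y :: real ^ 'k::finite. 0 < y $ i})"
  by (auto intro!: open_INT open_Collect_less continuous_intros)

lemma openin_simplex_open: "openin (top_of_set (simplex_hull S)) (simplex_open S)"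
  unfolding simplex_open_eq_Int using open_positive_coordinates by blast

lemma simplex_open_nonempty:
  assumes "S \<noteq> {}"
  shows "simplex_open S \<noteq> {}"
proof -
  have "(\<chi> i. if i \<in> S then 1 / real (card S) else 0) \<in> simplex_open S"
    using assms by (auto simp: simplex_open_def simplex_hull_def card_gt_0_iff)
  then show ?thesis by blast
qed

text \<open>A nonempty relatively open piece of an affine set already spans it. The sandwiched
  \<open>T\<close> covers both the choice set and the effective domain of the regularizer.\<close>

lemma affine_hull_between_simplices:
  assumes "S \<noteq> {}" "simplex_open S \<subseteq> T" "T \<subseteq> simplex_closed S"
  shows "affine hull T = simplex_hull S"
proof
  show "affine hull T \<subseteq> simplex_hull S"
    using assms(3) by (intro hull_minimal affine_simplex_hull) (auto simp: simplex_closed_def)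
  have "affine hull simplex_open S = affine hull simplex_hull S"
    using affine_hull_affine_Int_open[OF affine_simplex_hull open_positive_coordinates]
      simplex_open_nonempty[OF assms(1)] by (simp add: simplex_open_eq_Int)
  then show "simplex_hull S \<subseteq> affine hull T"
    using hull_mono[OF assms(2), of affine] hull_subset[of "simplex_hull S" affine] by simp
qed

lemma rel_interior_between_simplices:
  assumes "S \<noteq> {}" "simplex_open S \<subseteq> T" "T \<subseteq> simplex_closed S"
  shows "rel_interior T = simplex_open S"
proof
  note hull = affine_hull_between_simplices[OF assms]
    affine_hull_between_simplices[OF assms(1) simplex_open_subset_closed order_refl]
  show "simplex_open S \<subseteq> rel_interior T"
    using assms openin_simplex_open by (intro rel_interior_maximal) (auto simp: hull)
  \<comment> \<open>Monotonicity of the relative interior relies on both sets having the same affine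
    hull.\<close>
  have "rel_interior T \<subseteq> rel_interior (simplex_closed S)"
    using assms(3) by (intro subset_rel_interior) (auto simp: hull)
  also have "\<dots> \<subseteq> simplex_open S"
  proof
    fix x assume x: "x \<in> rel_interior (simplex_closed S)"
    then have xC: "x \<in> simplex_closed S" using rel_interior_subset by blast
    obtain p where p: "p \<in> simplex_open S"
      using simplex_open_nonempty[OF assms(1)] by blast
    \<comment> \<open>From a relative interior point one can move slightly further away from
      \<open>p\<close> without leaving the closed simplex. A coordinate of \<open>x\<close> that
      vanished would become negative, since that of \<open>p\<close> is positive.\<close>
    then obtain e where e: "e > 1" "(1 - e) *\<^sub>R p + e *\<^sub>R x \<in> simplex_closed S"
      using convex_rel_interior_if2[OF convex_simplex_closed x]
        hull_subset[of "simplex_closed S" affine] simplex_open_subset_closed by blast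
    have "0 < x $ i" if "i \<in> S" for i
    proof -
      have "0 \<le> (1 - e) * p $ i + e * x $ i"
        using e(2) by (simp add: simplex_closed_def)
      moreover have "(1 - e) * p $ i < 0"
        using p e(1) that by (simp add: simplex_open_def mult_neg_pos)
      ultimately show ?thesis
        using e(1) by (smt (verit) mult_nonneg_nonpos)
    qed
    with xC show "x \<in> simplex_open S"
      by (simp add: simplex_closed_def simplex_open_def)
  qed
  finally show "rel_interior T \<subseteq> simplex_open S" .
qed

text \<open>For empty \<open>S\<close> the hull is empty and has no differences, while the
  right-hand side contains 0.\<close>

lemma direction_space_simplex_hull:
  assumes "S \<noteq> {}"
  shows "direction_space (simplex_hull S) = {h. (\<Sum>i\<in>S. h $ i) = 0 \<and> (\<forall>i. i \<notin> S \<longrightarrow> h $ i = 0)}"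
proof (intro equalityI subsetI)
  fix h :: "real ^ 'a" assume h: "h \<in> {h. (\<Sum>i\<in>S. h $ i) = 0 \<and> (\<forall>i. i \<notin> S \<longrightarrow> h $ i = 0)}"
  obtain p where "p \<in> simplex_hull S"
    using simplex_open_nonempty[OF assms] by (auto simp: simplex_open_def)
  with h have "p + h \<in> simplex_hull S"
    by (simp add: simplex_hull_def sum.distrib)
  with \<open>p \<in> simplex_hull S\<close> show "h \<in> direction_space (simplex_hull S)"
    unfolding direction_space_def by (intro CollectI exI[of _ "p + h"] exI[of _ p]) simp
qed (auto simp: direction_space_def simplex_hull_def sum_subtractf)

text \<open>The gradient is the orthogonal projection of the derivatives \<open>\<phi>'\<close> onto
  the directions, that is, their mean over \<open>S\<close> is subtracted. The mean drops out of a
  difference of two entries, so it never has to be estimated.\<close>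

lemma gradient_along_simplex_diff:
  fixes S :: "'k::finite set"
  assumes "x \<in> simplex_open S" "i \<in> S" "j \<in> S"
    and f: "\<And>y. y \<in> simplex_open S \<Longrightarrow> f y = ereal (\<Sum>i\<in>S. \<phi> i (y $ i))"
    and d: "\<And>i. i \<in> S \<Longrightarrow> (\<phi> i has_real_derivative \<phi>' i) (at (x $ i))"
  shows "\<phi>' i - \<phi>' j \<le> 2 * norm (gradient_along (simplex_hull S) f x)"
proof -
  have "S \<noteq> {}" and x: "x \<in> simplex_hull S"
    using assms(1,2) by (auto simp: simplex_open_def)
  define \<mu> where "\<mu> = (\<Sum>i\<in>S. \<phi>' i) / real (card S)"
  define g where "g = (\<chi> i. if i \<in> S then \<phi>' i - \<mu> else 0)"
  have "gradient_along (simplex_hull S) f x = g"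
  proof (rule gradient_along_eqI[OF affine_simplex_hull x])
    show "g \<in> direction_space (simplex_hull S)"
      using \<open>S \<noteq> {}\<close>
      by (auto simp: direction_space_simplex_hull g_def \<mu>_def sum_subtractf card_gt_0_iff)
    show "((real_of_ereal \<circ> f) has_derivative (\<lambda>h. g \<bullet> h)) (at x within simplex_hull S)"
    proof (rule has_derivative_within_cong_directions[OF _ x bounded_linear_inner_right])
      show "((real_of_ereal \<circ> f) has_derivative (\<lambda>h. \<Sum>i\<in>S. \<phi>' i * h $ i)) (at x within simplex_hull S)"
        using has_derivative_within_transform_openin[OF openin_simplex_open assms(1) _
            separable_has_derivative[OF d]] f by fastforce
      show "g \<bullet> h = (\<Sum>i\<in>S. \<phi>' i * h $ i)" if "h \<in> direction_space (simplex_hull S)" for h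
      proof -
        have "g \<bullet> h = (\<Sum>i\<in>S. g $ i * h $ i)"
          unfolding inner_vec_def inner_real_def by (intro sum.mono_neutral_right) (auto simp: g_def)
        also have "\<dots> = (\<Sum>i\<in>S. \<phi>' i * h $ i) - \<mu> * (\<Sum>i\<in>S. h $ i)"
          by (simp add: g_def left_diff_distrib sum_subtractf sum_distrib_left)
        finally show ?thesis
          using that \<open>S \<noteq> {}\<close> by (simp add: direction_space_simplex_hull)
      qed
    qed
  qed
  moreover have "\<bar>g $ i\<bar> \<le> norm g" "\<bar>g $ j\<bar> \<le> norm g"
    using component_le_norm_cart by auto
  ultimately show ?thesis
    using assms(2,3) by (simp add: g_def)
qed

section \<open>Entropy with a logarithmic barrier\<close>

text \<open>One family serves all coordinates: \<open>c = 1\<close> at index \<open>None\<close>,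
  which carries the extra \<open>- ln\<close>, and \<open>c = 0\<close> elsewhere.\<close>

definition barrier_entropy :: "real \<Rightarrow> real \<Rightarrow> real" where
  "barrier_entropy c t = t * ln t - c * ln t"

text \<open>Closed forms of the iterated derivatives in \<open>t\<close>. Logarithms occur in orders
  0 and 1; from order 2 on only negative powers remain, so the last clause at \<open>m\<close> has
  order m + 2.\<close>

fun barrier_entropy_deriv :: "nat \<Rightarrow> real \<Rightarrow> real \<Rightarrow> real" where
  "barrier_entropy_deriv 0 c t = barrier_entropy c t"
| "barrier_entropy_deriv (Suc 0) c t = ln t + 1 - c / t"
| "barrier_entropy_deriv (Suc (Suc m)) c t =
     (- 1) ^ m * (fact m / t ^ Suc m + c * fact (Suc m) / t ^ Suc (Suc m))"

lemma barrier_entropy_deriv: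
  assumes "t > 0"
  shows "(barrier_entropy_deriv m c has_real_derivative barrier_entropy_deriv (Suc m) c t) (at t)"
proof -
  have inv: "((\<lambda>t. a / t ^ n) has_real_derivative - (a * real n / t ^ Suc n)) (at t)" if "n > 0" for a n
    using assms that
    by (auto intro!: derivative_eq_intros simp: field_simps power_eq_if[of t n])
  consider "m = 0" | "m = 1" | k where "m = Suc (Suc k)"
    by (metis One_nat_def not0_implies_Suc)
  then show ?thesis
  proof cases
    case 1
    then show ?thesis
      unfolding 1 barrier_entropy_deriv.simps[abs_def] barrier_entropy_def[abs_def]
      using assms by (auto intro!: derivative_eq_intros simp: field_simps)
  next
    case 2
    then show ?thesis
      unfolding 2 One_nat_def barrier_entropy_deriv.simps[abs_def]
      using assms by (auto intro!: derivative_eq_intros simp: field_simps power2_eq_square)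
  next
    case (3 k)
    have "((\<lambda>t. (- 1) ^ k * (fact k / t ^ Suc k + c * fact (Suc k) / t ^ Suc (Suc k)))
       has_real_derivative (- 1) ^ k * (- (fact k * real (Suc k) / t ^ Suc (Suc k))
          + - (c * fact (Suc k) * real (Suc (Suc k)) / t ^ Suc (Suc (Suc k))))) (at t)"
      by (intro DERIV_cmult DERIV_add inv) auto
    \<comment> \<open>The minus signs go into the alternating sign, the factors \<open>Suc k\<close>
      and \<open>Suc (Suc k)\<close> into the factorials.\<close>
    also have "(- 1) ^ k * (- (fact k * real (Suc k) / t ^ Suc (Suc k))
          + - (c * fact (Suc k) * real (Suc (Suc k)) / t ^ Suc (Suc (Suc k))))
        = barrier_entropy_deriv (Suc m) c t"
      unfolding 3 barrier_entropy_deriv.simps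
      by (simp only: fact_Suc of_nat_mult power_Suc[of "- 1 :: real"]) (simp add: algebra_simps add_divide_distrib diff_divide_distrib)
    finally show ?thesis
      unfolding 3 barrier_entropy_deriv.simps[abs_def] .
  qed
qed

lemma barrier_entropy_has_derivative:
  assumes "t > 0"
  shows "(barrier_entropy c has_real_derivative ln t + 1 - c / t) (at t)"
  using barrier_entropy_deriv[OF assms, of 0 c]
  unfolding barrier_entropy_deriv.simps[abs_def] by simp

text \<open>Both parts reduce to \<open>ln r \<le> r - 1\<close>: at \<open>r = s / t\<close> for
  the entropy, strictly since \<open>r \<noteq> 1\<close>, and at \<open>r = t / s\<close> for the
  barrier. Strictness comes from the entropy alone, so \<open>c = 0\<close> is allowed.\<close>

lemma barrier_entropy_tangent:
  assumes "c \<ge> 0" "s > 0" "t > 0" "s \<noteq> t"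
  shows "barrier_entropy c t > barrier_entropy c s + (ln s + 1 - c / s) * (t - s)"
proof -
  have "ln (s / t) < s / t - 1"
    using assms ln_le_minus_one[of "s / t"] ln_eq_minus_one[of "s / t"] by fastforce
  then have "t * (ln s - ln t) < t * (s / t - 1)"
    using assms by (simp add: ln_div)
  then have 1: "t * (ln s - ln t) < s - t"
    using assms by (simp add: right_diff_distrib)
  have "ln (t / s) \<le> t / s - 1"
    using assms by (intro ln_le_minus_one) auto
  then have "c * (ln t - ln s) \<le> c * (t / s - 1)"
    using assms by (intro mult_left_mono) (auto simp: ln_div)
  also have "\<dots> = c / s * (t - s)"
    using assms by (simp add: field_simps)
  finally show ?thesis
    using 1 unfolding barrier_entropy_def by (simp add: algebra_simps)
qed

section \<open>The regularizer\<close>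

lemma options0_nonempty: "options0 I \<noteq> {}" and None_in_options0: "None \<in> options0 I"
  by (auto simp: options0_def)

lemma choice_set_eq: "choice_set I = simplex_closed (options0 I)"
  by (auto simp: choice_set_def simplex_closed_def simplex_hull_def)

abbreviation barrier_weight :: "'n option \<Rightarrow> real" where
  "barrier_weight i \<equiv> of_bool (i = None)"

text \<open>The term \<open>ln (y $ None)\<close> couples all coordinates, but its coefficients add
  up to 1 on the hull, which leaves a single summand at \<open>None\<close>.\<close>

lemma Omega_eq:
  assumes "y \<in> simplex_open (options0 I)"
  shows "\<Omega> I y = ereal (\<Sum>i\<in>options0 I. barrier_entropy (barrier_weight i) (y $ i))"
proof -
  have y: "(\<Sum>i\<in>options0 I. y $ i) = 1" "\<And>i. i \<notin> options0 I \<Longrightarrow> y $ i = 0" "y $ None > 0"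
    using assms None_in_options0 by (auto simp: simplex_open_def simplex_hull_def)
  have "(\<Sum>i\<in>UNIV. y $ i * (ln (y $ i) - ln (y $ None))) =
      (\<Sum>i\<in>options0 I. y $ i * (ln (y $ i) - ln (y $ None)))"
    using y(2) by (intro sum.mono_neutral_right) auto
  also have "\<dots> = (\<Sum>i\<in>options0 I. y $ i * ln (y $ i)) - (\<Sum>i\<in>options0 I. y $ i) * ln (y $ None)"
    by (simp add: right_diff_distrib sum_subtractf sum_distrib_right)
  also have "\<dots> = (\<Sum>i\<in>options0 I. y $ i * ln (y $ i)) - (\<Sum>i\<in>options0 I. barrier_weight i * ln (y $ i))"
    using None_in_options0[of I] by (simp add: y(1) of_bool_def if_distrib[of "\<lambda>c. c * _"] cong: if_cong)
  also have "\<dots> = (\<Sum>i\<in>options0 I. barrier_entropy (barrier_weight i) (y $ i))"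
    by (simp add: barrier_entropy_def sum_subtractf)
  finally show ?thesis
    using assms y(3) simplex_open_subset_closed by (auto simp: \<Omega>_def choice_set_eq)
qed

lemma eff_domain_Omega: "eff_domain (\<Omega> I) = {y \<in> choice_set I. y $ None \<noteq> 0}"
  by (auto simp: eff_domain_def \<Omega>_def)

text \<open>The effective domain omits the face \<open>y $ None = 0\<close>, yet still lies between
  the open and the closed simplex.\<close>

lemma rel_interior_eff_domain_Omega: "rel_interior (eff_domain (\<Omega> I)) = simplex_open (options0 I)"
  using None_in_options0 simplex_open_subset_closed
  by (intro rel_interior_between_simplices options0_nonempty)
     (fastforce simp: eff_domain_Omega choice_set_eq simplex_open_def)+

lemma smooth_along_Omega:
  "smooth_along (simplex_hull (options0 I)) (simplex_open (options0 I)) (\<Omega> I)"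
  unfolding smooth_along_def
proof (intro conjI allI ballI)
  fix k
  show "C_along k (simplex_hull (options0 I)) (simplex_open (options0 I)) (real_of_ereal \<circ> \<Omega> I)"
    by (rule C_along_separable[OF affine_simplex_hull openin_simplex_open,
          where S = "options0 I" and D = "\<lambda>m i. barrier_entropy_deriv m (barrier_weight i)"
            and c = "\<lambda>_. 1" and m = 0])
       (auto simp: Omega_eq simplex_open_def intro!: barrier_entropy_deriv)
qed (simp add: Omega_eq)

lemma strictly_convex_on_Omega: "strictly_convex_on (simplex_open (options0 I)) (\<Omega> I)"
proof (rule strictly_convex_on_separable[where S = "options0 I"
      and \<phi> = "\<lambda>i. barrier_entropy (barrier_weight i)"
      and \<phi>' = "\<lambda>i s. ln s + 1 - barrier_weight i / s"])
  show "convex (simplex_open (options0 I))"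
    using convex_rel_interior[OF convex_simplex_closed]
      rel_interior_between_simplices[OF options0_nonempty simplex_open_subset_closed order_refl] by metis
  show "barrier_entropy (barrier_weight i) s + (ln s + 1 - barrier_weight i / s) * (t - s)
      < barrier_entropy (barrier_weight i) t" if "s > 0" "t > 0" "s \<noteq> t" for i :: "'a option" and s t
    using that by (intro barrier_entropy_tangent) auto
  show "x = y" if "x \<in> simplex_open (options0 I)" "y \<in> simplex_open (options0 I)"
    "\<And>i. i \<in> options0 I \<Longrightarrow> x $ i = y $ i" for x y
    using that by (auto simp: vec_eq_iff simplex_open_def simplex_hull_def) metis
qed (simp_all add: Omega_eq, simp add: simplex_open_def)

text \<open>Only the coordinates of \<open>z\<close> enter, so boundary points with finite and with
  infinite \<open>\<Omega> I z\<close> are treated alike.\<close>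

lemma gradient_Omega_at_top:
  assumes Y: "\<And>j::nat. Y j \<in> simplex_open (options0 I)" and "Y \<longlonglongrightarrow> z"
    and z: "z \<in> simplex_closed (options0 I) - simplex_open (options0 I)"
  shows "filterlim (\<lambda>j. norm (gradient_along (simplex_hull (options0 I)) (\<Omega> I) (Y j))) at_top sequentially"
proof -
  let ?O = "options0 I" and ?d = "\<lambda>i t :: real. ln t + 1 - barrier_weight i / t"
  obtain i where i: "i \<in> ?O" "z $ i = 0"
    using z by (force simp: simplex_closed_def simplex_open_def order_less_le)
  have "(\<Sum>i\<in>?O. z $ i) = 1"
    using z by (simp add: simplex_closed_def simplex_hull_def)
  then obtain k where k: "k \<in> ?O" "z $ k \<noteq> 0"
    by (metis sum.neutral zero_neq_one)
  have lim: "(\<lambda>j. Y j $ l) \<longlonglongrightarrow> z $ l" for l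
    using \<open>Y \<longlonglongrightarrow> z\<close> by (rule tendsto_vec_nth)
  have pos: "Y j $ l > 0" if "l \<in> ?O" for j l
    using Y that by (simp add: simplex_open_def)
  have "filterlim (\<lambda>j. Y j $ i) (at_right 0) sequentially"
    using lim[of i] i(2) pos[OF i(1)] by (simp add: filterlim_at less_imp_neq[symmetric])
  then have "filterlim (\<lambda>j. ln (Y j $ i)) at_bot sequentially"
    by (rule filterlim_compose[OF ln_at_0])
  then have ln_top: "filterlim (\<lambda>j. - ln (Y j $ i)) at_top sequentially"
    by (simp add: filterlim_uminus_at_bot)
  \<comment> \<open>The limit is finite as \<open>z $ k \<noteq> 0\<close>. The \<open>- 1\<close>
    is the constant of \<open>?d i\<close>, and the factor \<open>1/2\<close> below offsets the 2 in
    the gradient bound.\<close>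
  have "(\<lambda>j. ?d k (Y j $ k) - 1) \<longlonglongrightarrow> ?d k (z $ k) - 1"
    by (intro tendsto_intros lim k)
  from filterlim_at_top_mult_tendsto_pos[OF tendsto_const[of "1/2"] _
      filterlim_tendsto_add_at_top[OF this ln_top]]
  have "filterlim (\<lambda>j. ((?d k (Y j $ k) - 1) + - ln (Y j $ i)) * (1/2)) at_top sequentially"
    by simp
  then show ?thesis
  proof (rule filterlim_at_top_mono, intro always_eventually allI)
    fix j
    have "?d k (Y j $ k) - ?d i (Y j $ i) \<le>
        2 * norm (gradient_along (simplex_hull ?O) (\<Omega> I) (Y j))"
      by (rule gradient_along_simplex_diff[OF Y k(1) i(1) Omega_eq barrier_entropy_has_derivative])
         (use pos in auto)
    moreover have "barrier_weight i / (Y j $ i) \<ge> 0"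
      using pos[OF i(1), of j] by (simp add: less_imp_le)
    ultimately show "((?d k (Y j $ k) - 1) + - ln (Y j $ i)) * (1/2) \<le>
        norm (gradient_along (simplex_hull ?O) (\<Omega> I) (Y j))"
      by (simp add: field_simps)
  qed
qed

theorem proposition1:
  fixes I :: "nat ^ 'n::finite"
  shows "smooth_along (affine hull (choice_set I)) (rel_interior (choice_set I)) (\<Omega> I) \<and>
         strictly_convex_on (rel_interior (choice_set I)) (\<Omega> I) \<and>
         legendre_type (choice_set I) (\<Omega> I)"
proof -
  let ?O = "options0 I"
  have hull: "affine hull (choice_set I) = simplex_hull ?O"
    and int: "rel_interior (choice_set I) = simplex_open ?O"
    unfolding choice_set_eq
    by (simp_all add: affine_hull_between_simplices rel_interior_between_simplices
        simplex_open_subset_closed options0_nonempty)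
  have frontier: "rel_frontier (choice_set I) = simplex_closed ?O - simplex_open ?O"
    unfolding rel_frontier_def int by (simp add: choice_set_eq closure_closed closed_simplex_closed)
  \<comment> \<open>Order one of smoothness already contains differentiability along the
    hull.\<close>
  have "C_along (Suc 0) (simplex_hull ?O) (simplex_open ?O) (real_of_ereal \<circ> \<Omega> I)"
    using smooth_along_Omega unfolding smooth_along_def by blast
  then have "differentiable_along (simplex_hull ?O) (\<Omega> I) x" if "x \<in> simplex_open ?O" for x
    using that by (simp add: differentiable_along_def Omega_eq)
  then have "legendre_type (choice_set I) (\<Omega> I)"
    unfolding legendre_type_def rel_interior_eff_domain_Omega hull frontier
    using simplex_open_nonempty[OF options0_nonempty] strictly_convex_on_Omega gradient_Omega_at_top
    by blast
  then show ?thesis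
    unfolding hull int using smooth_along_Omega strictly_convex_on_Omega by blast
qed

end
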